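(* Let $A=(a_{ij})_{i,j=1,2}$ be a real matrix with $w=\det A\neq 0$, let $f,g$ be smooth real functions of one variable defined on open intervals, and consider in the Galilean space $\mathbb{G}_3$ the affine translation surface $$r(x,y)=\bigl(x,\;y,\;f(a_{11}x+a_{12}y)+g(a_{21}x+a_{22}y)\bigr).$$ Suppose it has constant mean curvature $H_0$. Then: (1) If $H_0=0$, the surface is either (1.1) an isotropic plane, or (1.2) a generalized cylinder with isotropic rulings, or (1.3) a non-cylindrical ruled surface of type C whose base curve is a parabolic circle. (2) If $H_0\neq 0$, then, up to translations and up to interchanging the roles of $(f,a_{11},a_{12})$ and $(g,a_{21},a_{22})$, writing $v=a_{21}x+a_{22}y$, the surface is either (2.1) a surface given (with $a_{12}=0$) by $$r(x,y)=\left(x,\;y,\;f(a_{11}x)-\frac1{H_0}\sqrt{1-\left(\frac{H_0}{a_{22}}v\right)^2}\right),\quad a_{22}\neq 0,$$ or (2.2) a generalized cylinder with non-isotropic rulings given by $$r(x,y)=\left(x,\;y,\;\frac{c_1w}{a_{22}}x-\frac1{H_0}\sqrt{1-\left(\frac{H_0}{a_{22}}v\right)^2}\right),\quad a_{22}\neq 0,$$ for some $c_1\in\mathbb{R}$.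
   Context: The affine model of the Galilean 3-space $\mathbb{G}_3$ is $\mathbb{R}^3$ with coordinates $(x,y,z)$; its motions are the maps $x'=a+x$, $y'=b+cx+(\cos\theta)y+(\sin\theta)z$, $z'=d+ex-(\sin\theta)y+(\cos\theta)z$ with real constants $a,b,c,d,e,\theta$. A vector is isotropic if its first component is $0$, and non-isotropic otherwise. A plane is Euclidean if it has the form $x=\text{const}$, and isotropic otherwise. Curvatures of a surface $r(u_1,u_2)=(x,y,z)$ (with $x_{,i}=\partial x/\partial u_i$, $x_{,ij}=\partial^2x/\partial u_i\partial u_j$, etc.): put $g_i=x_{,i}$, assume $x_{,i}\ne 0$ for some $i$ at each point (admissibility), and set $$W=\sqrt{(x_{,1}z_{,2}-x_{,2}z_{,1})^2+(x_{,2}y_{,1}-x_{,1}y_{,2})^2}>0,\qquad N=\tfrac1W\bigl(0,\,-x_{,1}z_{,2}+x_{,2}z_{,1},\,x_{,1}y_{,2}-x_{,2}y_{,1}\bigr),$$ $$L_{ij}=\tfrac1{g_k}\bigl(g_k(0,y_{,ij},z_{,ij})-x_{,ij}(0,y_{,k},z_{,k})\bigr)\cdot N$$ for an index $k$ with $g_k\neq 0$, where $\cdot$ is the Euclidean scalar product. The mean curvature is normalized as $H=(g_2^2L_{11}-2g_1g_2L_{12}+g_1^2L_{22})/W^2$; for the surface in the claim this is $H=\dfrac{a_{12}^2f''+a_{22}^2g''}{[1+(a_{12}f'+a_{22}g')^2]^{3/2}}$. A generalized cylinder (cylindrical surface) is a surface that can be parameterized as $\gamma(t)+\lambda e$ with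 $\gamma$ a curve and $e\neq 0$ a constant vector; its rulings are isotropic or non-isotropic according to whether $e$ is. A ruled surface of type C is one that, up to a motion of $\mathbb{G}_3$, can be parameterized as $(u,v)\mapsto(u,\,X(u)+vY(u),\,vZ(u))$, with base curve $u\mapsto (u,X(u),0)$. A parabolic circle is a non-isotropic planar curve of constant nonzero Galilean curvature, i.e. up to a motion a curve $x\mapsto(x,cx^2,0)$ with $c\neq 0$. Convention: with $u=a_{11}x+a_{12}y$ and $v=a_{21}x+a_{22}y$, $f=f(u)$ and $g=g(v)$ are defined on open intervals $I$, $J$, and the surface is considered on all $(x,y)$ with $u\in I$, $v\in J$; in (2) the formulas describe the surface on its domain. *)

theory Defs
  imports "HOL-Analysis.Analysis"
begin

text \<open>Smoothness of a function of one real variable on an open set. Only values on the set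
  matter, because every derivative is taken at interior points.\<close>

definition smooth_on :: "real set \<Rightarrow> (real \<Rightarrow> 'a::real_normed_vector) \<Rightarrow> bool" where
  "smooth_on S f \<longleftrightarrow>
     (\<forall>n. \<forall>t\<in>S. (((\<lambda>h t. vector_derivative h (at t)) ^^ n) f) differentiable (at t))"

definition open_interval :: "real set \<Rightarrow> bool" where
  "open_interval S \<longleftrightarrow> S \<noteq> {} \<and> open S \<and> is_interval S"


subsection \<open>Galilean 3-space\<close>

definition galilean_motion :: "(real^3 \<Rightarrow> real^3) \<Rightarrow> bool" where
  "galilean_motion \<phi> \<longleftrightarrow> (\<exists>a b c d e \<theta>. \<phi> = (\<lambda>q. vector
     [a + q$1,
      b + c * q$1 + cos \<theta> * q$2 + sin \<theta> * q$3,
      d + e * q$1 - sin \<theta> * q$2 + cos \<theta> * q$3]))"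

definition isotropic_vector :: "real^3 \<Rightarrow> bool" where
  "isotropic_vector e \<longleftrightarrow> e$1 = 0"

definition plane3 :: "(real^3) set \<Rightarrow> bool" where
  "plane3 P \<longleftrightarrow> affine P \<and> aff_dim P = 2"

definition euclidean_plane :: "(real^3) set \<Rightarrow> bool" where
  "euclidean_plane P \<longleftrightarrow> (\<exists>c. P = {q. q$1 = c})"

definition isotropic_plane :: "(real^3) set \<Rightarrow> bool" where
  "isotropic_plane P \<longleftrightarrow> plane3 P \<and> \<not> euclidean_plane P"


subsection \<open>Mean curvature of a parametrized surface\<close>

definition pd :: "2 \<Rightarrow> (real^2 \<Rightarrow> real^3) \<Rightarrow> real^2 \<Rightarrow> real^3" where
  "pd i r p = vector_derivative (\<lambda>t. r (p + t *\<^sub>R axis i 1)) (at 0)"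

definition surf_W :: "(real^2 \<Rightarrow> real^3) \<Rightarrow> real^2 \<Rightarrow> real" where
  "surf_W r p = sqrt
     ((pd 1 r p $ 1 * pd 2 r p $ 3 - pd 2 r p $ 1 * pd 1 r p $ 3)\<^sup>2 +
      (pd 2 r p $ 1 * pd 1 r p $ 2 - pd 1 r p $ 1 * pd 2 r p $ 2)\<^sup>2)"

definition surf_N :: "(real^2 \<Rightarrow> real^3) \<Rightarrow> real^2 \<Rightarrow> real^3" where
  "surf_N r p = (1 / surf_W r p) *\<^sub>R vector
     [0,
      - (pd 1 r p $ 1 * pd 2 r p $ 3) + pd 2 r p $ 1 * pd 1 r p $ 3,
      pd 1 r p $ 1 * pd 2 r p $ 2 - pd 2 r p $ 1 * pd 1 r p $ 2]"

definition drop_x :: "real^3 \<Rightarrow> real^3" where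
  "drop_x q = vector [0, q$2, q$3]"

definition surf_L :: "(real^2 \<Rightarrow> real^3) \<Rightarrow> real^2 \<Rightarrow> 2 \<Rightarrow> 2 \<Rightarrow> 2 \<Rightarrow> real" where
  "surf_L r p k i j =
     ((1 / pd k r p $ 1) *\<^sub>R
        (pd k r p $ 1 *\<^sub>R drop_x (pd i (pd j r) p)
         - pd i (pd j r) p $ 1 *\<^sub>R drop_x (pd k r p))) \<bullet> surf_N r p"

text \<open>The coefficients \<open>surf_L r p k i j\<close> do not depend on the index \<open>k\<close> with
  \<open>pd k r p $ 1 \<noteq> 0\<close>; such a \<open>k\<close> exists at an admissible point.\<close>

definition mean_curvature :: "(real^2 \<Rightarrow> real^3) \<Rightarrow> real^2 \<Rightarrow> real" where
  "mean_curvature r p =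
     (let g1 = pd 1 r p $ 1; g2 = pd 2 r p $ 1; k = (SOME k. pd k r p $ 1 \<noteq> 0);
          L = surf_L r p k
      in (g2\<^sup>2 * L 1 1 - 2 * g1 * g2 * L 1 2 + g1\<^sup>2 * L 2 2) / (surf_W r p)\<^sup>2)"


subsection \<open>Classes of surfaces\<close>

text \<open>Surfaces are subsets of \<open>\<real>\<^sup>3\<close>. A parametrization is a regular one on a connected open
  parameter domain \<open>D\<close>, which need not be a product; a curve involved in it is defined on the
  open interval \<open>fst ` D\<close>.\<close>

definition cylinder_with_ruling :: "real^3 \<Rightarrow> (real^3) set \<Rightarrow> bool" where
  "cylinder_with_ruling e S \<longleftrightarrow> e \<noteq> 0 \<and>
     (\<exists>(\<gamma> :: real \<Rightarrow> real^3) (D :: (real \<times> real) set).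
        open D \<and> connected D \<and> smooth_on (fst ` D) \<gamma> \<and>
        (\<forall>t\<in>fst ` D. vector_derivative \<gamma> (at t) \<notin> span {e}) \<and>
        S = (\<lambda>(t, s). \<gamma> t + s *\<^sub>R e) ` D)"

definition generalized_cylinder :: "(real^3) set \<Rightarrow> bool" where
  "generalized_cylinder S \<longleftrightarrow> (\<exists>e. cylinder_with_ruling e S)"

definition type_C_parametrization ::
  "(real \<Rightarrow> real) \<Rightarrow> (real \<Rightarrow> real) \<Rightarrow> (real \<Rightarrow> real) \<Rightarrow> (real \<times> real) set \<Rightarrow> (real^3) set \<Rightarrow> bool" where
  "type_C_parametrization X Y Z D S \<longleftrightarrow>
     open D \<and> connected D \<and>
     smooth_on (fst ` D) X \<and> smooth_on (fst ` D) Y \<and> smooth_on (fst ` D) Z \<and>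
     (\<forall>u\<in>fst ` D. (Y u, Z u) \<noteq> (0, 0)) \<and>
     S = (\<lambda>(u, v). vector [u, X u + v * Y u, v * Z u]) ` D"

text \<open>An arc of a parabolic circle, over an open interval \<open>K\<close>.\<close>

definition parabolic_circle :: "(real^3) set \<Rightarrow> bool" where
  "parabolic_circle C \<longleftrightarrow> (\<exists>\<phi> c K. galilean_motion \<phi> \<and> c \<noteq> 0 \<and> open_interval K \<and>
     \<phi> ` C = (\<lambda>x. vector [x, c * x\<^sup>2, 0]) ` K)"

definition type_C_over_parabolic_circle :: "(real^3) set \<Rightarrow> bool" where
  "type_C_over_parabolic_circle S \<longleftrightarrow>
     (\<exists>\<phi> X Y Z D. galilean_motion \<phi> \<and> type_C_parametrization X Y Z D (\<phi> ` S) \<and>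
        parabolic_circle ((\<lambda>u. vector [u, X u, 0]) ` fst ` D))"


subsection \<open>Affine translation surfaces\<close>

definition translation_map ::
  "real^2^2 \<Rightarrow> (real \<Rightarrow> real) \<Rightarrow> (real \<Rightarrow> real) \<Rightarrow> real^2 \<Rightarrow> real^3" where
  "translation_map A f g p = vector
     [p$1, p$2, f (A$1$1 * p$1 + A$1$2 * p$2) + g (A$2$1 * p$1 + A$2$2 * p$2)]"

definition translation_domain :: "real^2^2 \<Rightarrow> real set \<Rightarrow> real set \<Rightarrow> (real^2) set" where
  "translation_domain A U V =
     {p. A$1$1 * p$1 + A$1$2 * p$2 \<in> U \<and> A$2$1 * p$1 + A$2$2 * p$2 \<in> V}"

definition swap_rows :: "real^2^2 \<Rightarrow> real^2^2" where
  "swap_rows A = vector [A$2, A$1]"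

text \<open>\<open>S\<close> is, after a translation of the space, the part over some \<open>E\<close> of the graph of \<open>h\<close>;
  the formula for \<open>h\<close> is meaningful on the set \<open>M\<close> only.\<close>

definition translated_graph :: "(real^2 \<Rightarrow> real) \<Rightarrow> (real^2) set \<Rightarrow> (real^3) set \<Rightarrow> bool" where
  "translated_graph h M S \<longleftrightarrow>
     (\<exists>\<tau> E. E \<subseteq> M \<and> (\<lambda>q. q + \<tau>) ` S = (\<lambda>p. vector [p$1, p$2, h p]) ` E)"

text \<open>In the next two definitions \<open>v = A$2$1 * p$1 + A$2$2 * p$2\<close> is the second coordinate
  of \<open>A *v p\<close>.\<close>

definition cmc_form_1 ::
  "real^2^2 \<Rightarrow> (real \<Rightarrow> real) \<Rightarrow> real set \<Rightarrow> real \<Rightarrow> (real^3) set \<Rightarrow> bool" where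
  "cmc_form_1 A f U H0 S \<longleftrightarrow> A$1$2 = 0 \<and> A$2$2 \<noteq> 0 \<and>
     translated_graph
       (\<lambda>p. f (A$1$1 * p$1) - 1 / H0 * sqrt (1 - (H0 / A$2$2 * (A$2$1 * p$1 + A$2$2 * p$2))\<^sup>2))
       {p. A$1$1 * p$1 \<in> U \<and> 0 \<le> 1 - (H0 / A$2$2 * (A$2$1 * p$1 + A$2$2 * p$2))\<^sup>2} S"

definition cmc_form_2 :: "real^2^2 \<Rightarrow> real \<Rightarrow> (real^3) set \<Rightarrow> bool" where
  "cmc_form_2 A H0 S \<longleftrightarrow> A$2$2 \<noteq> 0 \<and>
     (\<exists>e. cylinder_with_ruling e S \<and> \<not> isotropic_vector e) \<and>
     (\<exists>c1. translated_graph
       (\<lambda>p. c1 * det A / A$2$2 * p$1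
              - 1 / H0 * sqrt (1 - (H0 / A$2$2 * (A$2$1 * p$1 + A$2$2 * p$2))\<^sup>2))
       {p. 0 \<le> 1 - (H0 / A$2$2 * (A$2$1 * p$1 + A$2$2 * p$2))\<^sup>2} S)"

end

(* The mean curvature equation reads b^2 f''(u) + d^2 g''(v) = H0 (1 + (b f'(u) + d g'(v))^2)^(3/2) with
   b = a12, d = a22. For H0 = 0 it separates: either one function is affine, which gives a cylinder with
   rulings parallel to the yz-plane (isotropic planes included), or f and g are quadratic polynomials with opposite
   leading terms, whose graph is a hyperbolic paraboloid m x^2 + n x y + linear terms with n nonzero.
   For H0 nonzero, the mixed derivative in u and v of the right-hand side vanishes, and by convexity of
   (1 + s^2)^(3/2) one of b f', d g' is constant; what remains is the equation of a circle for the
   other function. *)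

theory Submission
  imports Defs
begin

text \<open>Since \<open>det A \<noteq> 0\<close>, the numbers u and v range independently over
  \<open>U\<close> and \<open>V\<close>; only this turns the curvature condition into an equation in
  separate variables. The equation involves f only through b f' and b^2 f'', so b = 0 leaves f
  arbitrary. This is the origin of the split for H0 nonzero: b f' constant means either b = 0, which
  gives (2.1), or f affine, which gives (2.2). For H0 = 0 the paraboloid has to be told apart from
  every cylinder, although straight lines run through each of its points; what excludes a cylinder
  is that one fixed direction would have to be tangent over an open set. In the (x, y)-plane the
  domain is an intersection of two open strips and not a product, so the parametrizations live on
  convex open sets.\<close>

section \<open>Vectors in coordinates and smooth functions\<close>

lemma vector_3_eq: "(vector [x, y, z] :: real^3) = x *\<^sub>R axis 1 1 + y *\<^sub>R axis 2 1 + z *\<^sub>R axis 3 1"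
  by (simp add: vec_eq_iff forall_3 vector_3 axis_def)

lemma has_vector_derivative_scaleR_const:
  assumes "(f has_real_derivative f') (at t)"
  shows "((\<lambda>t. f t *\<^sub>R E) has_vector_derivative f' *\<^sub>R E) (at t)"
  using has_vector_derivative_scaleR[OF assms has_vector_derivative_const[of E]] by simp

lemma has_vector_derivative_vector_3:
  assumes "(\<alpha> has_real_derivative \<alpha>') (at t)" "(\<beta> has_real_derivative \<beta>') (at t)"
    "(\<gamma> has_real_derivative \<gamma>') (at t)"
  shows "((\<lambda>t. vector [\<alpha> t, \<beta> t, \<gamma> t] :: real^3) has_vector_derivative vector [\<alpha>', \<beta>', \<gamma>']) (at t)"
  unfolding vector_3_eq by (intro has_vector_derivative_add has_vector_derivative_scaleR_const assms)

lemma inner_vector_3: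
  "(vector [x, y, z] :: real^3) \<bullet> vector [x', y', z'] = x * x' + y * y' + z * z'"
  by (simp add: inner_vec_def sum_3 vector_3)

lemma smooth_onD:
  fixes f :: "real \<Rightarrow> real"
  assumes "smooth_on U f" "t \<in> U"
  defines "D \<equiv> \<lambda>h t. vector_derivative h (at t)"
  shows "((D ^^ n) f has_real_derivative (D ^^ Suc n) f t) (at t)"
proof -
  have "(D ^^ n) f differentiable (at t)"
    using assms(1,2) by (simp add: smooth_on_def D_def)
  then show ?thesis
    by (simp add: D_def vector_derivative_works has_real_derivative_iff_has_vector_derivative)
qed

lemma smooth_on_real_cases:
  fixes f :: "real \<Rightarrow> real"
  assumes "smooth_on U f"
  obtains f' f'' where "\<And>t. t \<in> U \<Longrightarrow> (f has_real_derivative f' t) (at t)"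
    "\<And>t. t \<in> U \<Longrightarrow> (f' has_real_derivative f'' t) (at t)"
  using smooth_onD[OF assms, of _ 0] smooth_onD[OF assms, of _ 1]
  by (intro that[of "\<lambda>t. vector_derivative f (at t)"]) auto

text \<open>Curves of this shape are closed under differentiation: \<open>P\<close>,
  \<open>Q\<close>, \<open>E\<close> become \<open>Q\<close>, \<open>0\<close>,
  \<open>a *\<^sub>R E\<close>, and \<open>f\<close> becomes its derivative. The induction therefore
  carries existentially quantified vectors. The base curves of all cylinders below have this
  shape.\<close>

lemma smooth_on_affine_comp:
  fixes f :: "real \<Rightarrow> real" and P Q E :: "'a::real_normed_vector"
  assumes f: "smooth_on U f" and "open S" and SU: "\<And>t. t \<in> S \<Longrightarrow> a * t \<in> U"
  shows "smooth_on S (\<lambda>t. P + t *\<^sub>R Q + f (a * t) *\<^sub>R E)"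
proof -
  define D where "D = (\<lambda>h (t::real). vector_derivative h (at t) :: 'a)"
  define d where "d = (\<lambda>h (t::real). vector_derivative h (at t) :: real)"
  define r where "r = (\<lambda>t. P + t *\<^sub>R Q + f (a * t) *\<^sub>R E)"
  have der: "(h has_vector_derivative Q + (d ^^ Suc n) f (a * t) *\<^sub>R (a *\<^sub>R E)) (at t)"
    if h: "\<And>t. t \<in> S \<Longrightarrow> h t = P + t *\<^sub>R Q + (d ^^ n) f (a * t) *\<^sub>R E" and t: "t \<in> S"
    for h n t and P Q E :: 'a
  proof -
    have "((d ^^ n) f has_real_derivative (d ^^ Suc n) f (a * t)) (at (a * t))"
      using smooth_onD[OF f SU[OF t]] by (simp add: d_def)
    then have "((\<lambda>t. (d ^^ n) f (a * t)) has_real_derivative (d ^^ Suc n) f (a * t) * a) (at t)"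
      by (rule DERIV_chain2) (auto intro!: derivative_eq_intros)
    then have "((\<lambda>t. P + t *\<^sub>R Q + (d ^^ n) f (a * t) *\<^sub>R E) has_vector_derivative
        0 + 1 *\<^sub>R Q + ((d ^^ Suc n) f (a * t) * a) *\<^sub>R E) (at t)"
      by (intro has_vector_derivative_add has_vector_derivative_scaleR_const has_vector_derivative_const)
        (auto intro!: derivative_eq_intros)
    then show ?thesis
      using has_vector_derivative_transform_within_open[OF _ \<open>open S\<close> t] h by fastforce
  qed
  have "\<exists>P Q E. \<forall>t\<in>S. (D ^^ n) r t = P + t *\<^sub>R Q + (d ^^ n) f (a * t) *\<^sub>R E" for n
  proof (induction n)
    case 0
    show ?case by (auto simp: r_def)
  next
    case (Suc n)
    then obtain P Q E where "\<And>t. t \<in> S \<Longrightarrow> (D ^^ n) r t = P + t *\<^sub>R Q + (d ^^ n) f (a * t) *\<^sub>R E"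
      by blast
    from der[OF this] have "\<forall>t\<in>S. (D ^^ Suc n) r t = Q + t *\<^sub>R 0 + (d ^^ Suc n) f (a * t) *\<^sub>R (a *\<^sub>R E)"
      by (auto simp: D_def intro!: vector_derivative_at)
    then show ?case by blast
  qed
  with der have "(D ^^ n) r differentiable (at t)" if "t \<in> S" for n t
    using that by (meson differentiableI_vector)
  then show ?thesis
    by (simp add: smooth_on_def D_def r_def)
qed

lemma smooth_on_poly: "smooth_on S (poly p)" for p :: "real poly"
proof -
  have der: "(poly q has_vector_derivative poly (pderiv q) t) (at t)" for q :: "real poly" and t
    using poly_DERIV[of q t] by (simp add: has_real_derivative_iff_has_vector_derivative)
  have "((\<lambda>h t. vector_derivative h (at t)) ^^ n) (poly p) = poly ((pderiv ^^ n) p)" for n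
    by (induction n) (auto simp: vector_derivative_at[OF der])
  then show ?thesis
    using der by (auto simp: smooth_on_def intro: differentiableI_vector)
qed

section \<open>The graph, its domain and its mean curvature\<close>

lemma translation_map_swap: "translation_map (swap_rows A) g f = translation_map A f g"
  by (simp add: fun_eq_iff translation_map_def swap_rows_def add.commute)

lemma translation_domain_swap: "translation_domain (swap_rows A) V U = translation_domain A U V"
  by (auto simp: translation_domain_def swap_rows_def)

lemma det_swap_rows: "det (swap_rows A) = - det A"
  by (simp add: swap_rows_def det_2)

lemma translation_domain_vimage:
  "translation_domain A U V = (\<lambda>p. A$1$1 * p$1 + A$1$2 * p$2) -` U \<inter> (\<lambda>p. A$2$1 * p$1 + A$2$2 * p$2) -` V"
  by (auto simp: translation_domain_def)

lemma open_translation_domain: "open U \<Longrightarrow> open V \<Longrightarrow> open (translation_domain A U V)"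
  unfolding translation_domain_vimage by (intro open_Int open_vimage continuous_intros)

lemma ex_coordinates:
  fixes A :: "real^2^2"
  assumes "det A \<noteq> 0"
  obtains p :: "real^2" where "A$1$1 * p$1 + A$1$2 * p$2 = s" "A$2$1 * p$1 + A$2$2 * p$2 = t"
proof -
  obtain p where "A *v p = vector [s, t]"
    using assms by (metis invertible_det_nz invertible_def matrix_vector_mul_assoc matrix_vector_mul_lid)
  then show ?thesis
    using that by (auto simp: vec_eq_iff forall_2 matrix_vector_mult_def sum_2)
qed

lemma pd_translation_map:
  assumes p: "p \<in> translation_domain A U V"
    and f: "\<And>t. t \<in> U \<Longrightarrow> (f has_real_derivative f' t) (at t)"
    and g: "\<And>t. t \<in> V \<Longrightarrow> (g has_real_derivative g' t) (at t)"
  shows "pd i (translation_map A f g) p = vector [axis i 1 $ 1, axis i 1 $ 2,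
     A$1$i * f' (A$1$1 * p$1 + A$1$2 * p$2) + A$2$i * g' (A$2$1 * p$1 + A$2$2 * p$2)]"
proof -
  have lin: "A$k$1 * (p + t *\<^sub>R axis i 1)$1 + A$k$2 * (p + t *\<^sub>R axis i 1)$2
      = A$k$1 * p$1 + A$k$2 * p$2 + t * A$k$i" for k t
    using exhaust_2[of i] by (auto simp: axis_def algebra_simps)
  have "((\<lambda>t. translation_map A f g (p + t *\<^sub>R axis i 1)) has_vector_derivative
      vector [axis i 1 $ 1, axis i 1 $ 2, f' (A$1$1 * p$1 + A$1$2 * p$2) * A$1$i
        + g' (A$2$1 * p$1 + A$2$2 * p$2) * A$2$i]) (at 0)"
    unfolding translation_map_def lin
  proof (rule has_vector_derivative_vector_3)
    have "((\<lambda>t. f (A$1$1 * p$1 + A$1$2 * p$2 + t * A$1$i)) has_real_derivative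
        f' (A$1$1 * p$1 + A$1$2 * p$2) * A$1$i) (at 0)"
      using p by (intro DERIV_chain2[where f=f])
        (auto simp: translation_domain_def intro!: derivative_eq_intros f)
    moreover have "((\<lambda>t. g (A$2$1 * p$1 + A$2$2 * p$2 + t * A$2$i)) has_real_derivative
        g' (A$2$1 * p$1 + A$2$2 * p$2) * A$2$i) (at 0)"
      using p by (intro DERIV_chain2[where f=g])
        (auto simp: translation_domain_def intro!: derivative_eq_intros g)
    ultimately show "((\<lambda>t. f (A$1$1 * p$1 + A$1$2 * p$2 + t * A$1$i)
        + g (A$2$1 * p$1 + A$2$2 * p$2 + t * A$2$i)) has_real_derivative
        f' (A$1$1 * p$1 + A$1$2 * p$2) * A$1$i + g' (A$2$1 * p$1 + A$2$2 * p$2) * A$2$i) (at 0)"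
      by (rule DERIV_add)
  qed (auto intro!: derivative_eq_intros)
  then show ?thesis
    by (simp add: pd_def vector_derivative_at mult.commute)
qed

text \<open>The parameters are x and y themselves, so \<open>g1 = 1\<close> and
  \<open>g2 = 0\<close> in the definition of \<open>mean_curvature\<close>, and only the coefficient
  with both indices 2 survives. The cube collects two factors \<open>surf_W\<close> from that
  definition and one from the normal.\<close>

lemma mean_curvature_translation_map:
  assumes U: "open U" and V: "open V" and p: "p \<in> translation_domain A U V"
    and f: "\<And>t. t \<in> U \<Longrightarrow> (f has_real_derivative f' t) (at t)"
    and f': "\<And>t. t \<in> U \<Longrightarrow> (f' has_real_derivative f'' t) (at t)"
    and g: "\<And>t. t \<in> V \<Longrightarrow> (g has_real_derivative g' t) (at t)"
    and g': "\<And>t. t \<in> V \<Longrightarrow> (g' has_real_derivative g'' t) (at t)"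
  defines "u \<equiv> A$1$1 * p$1 + A$1$2 * p$2" and "v \<equiv> A$2$1 * p$1 + A$2$2 * p$2"
  shows "mean_curvature (translation_map A f g) p =
    ((A$1$2)\<^sup>2 * f'' u + (A$2$2)\<^sup>2 * g'' v) / sqrt (1 + (A$1$2 * f' u + A$2$2 * g' v)\<^sup>2) ^ 3"
proof -
  let ?r = "translation_map A f g"
  have pd: "pd i ?r q = vector [axis i 1 $ 1, axis i 1 $ 2,
      A$1$i * f' (A$1$1 * q$1 + A$1$2 * q$2) + A$2$i * g' (A$2$1 * q$1 + A$2$2 * q$2)]"
    if "q \<in> translation_domain A U V" for q i
    using that f g by (rule pd_translation_map)
  \<comment> \<open>The third component of \<open>pd 2 ?r\<close> along the line through
    \<open>p\<close> in the y-direction. The formula for \<open>pd\<close> holds on the domain only;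
    \<open>?T\<close> is the open set of parameters for which the line stays there.\<close>
  define h where "h = (\<lambda>t. A$1$2 * f' (u + t * A$1$2) + A$2$2 * g' (v + t * A$2$2))"
  let ?T = "(\<lambda>t. p + t *\<^sub>R axis 2 1) -` translation_domain A U V"
  have uv: "u \<in> U" "v \<in> V"
    using p by (auto simp: translation_domain_def u_def v_def)
  have lin: "A$k$1 * (p + t *\<^sub>R axis 2 1)$1 + A$k$2 * (p + t *\<^sub>R axis 2 1)$2
      = A$k$1 * p$1 + A$k$2 * p$2 + t * A$k$2" for k t
    by (simp add: axis_def algebra_simps)
  have "(h has_real_derivative A$1$2 * (f'' u * A$1$2) + A$2$2 * (g'' v * A$2$2)) (at 0)"
    unfolding h_def
    by (intro DERIV_add DERIV_cmult DERIV_chain2[where f=f'] DERIV_chain2[where f=g'])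
      (auto intro!: derivative_eq_intros f' g' uv)
  then have "((\<lambda>t. vector [0, 1, h t] :: real^3) has_vector_derivative
      vector [0, 0, A$1$2 * (f'' u * A$1$2) + A$2$2 * (g'' v * A$2$2)]) (at 0)"
    by (intro has_vector_derivative_vector_3) (auto intro!: derivative_eq_intros)
  moreover have "open ?T"
    by (intro open_vimage open_translation_domain U V continuous_intros)
  moreover have "0 \<in> ?T"
    using p by simp
  moreover have "vector [0, 1, h t] = pd 2 ?r (p + t *\<^sub>R axis 2 1)" if "t \<in> ?T" for t
  proof -
    have q: "p + t *\<^sub>R axis 2 1 \<in> translation_domain A U V"
      using that by simp
    have ax: "axis (2::2) 1 $ 1 = (0::real)" "axis (2::2) 1 $ 2 = (1::real)"
      by (simp_all add: axis_def)
    show ?thesis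
      unfolding pd[OF q] lin ax h_def u_def v_def ..
  qed
  ultimately have "((\<lambda>t. pd 2 ?r (p + t *\<^sub>R axis 2 1)) has_vector_derivative
      vector [0, 0, A$1$2 * (f'' u * A$1$2) + A$2$2 * (g'' v * A$2$2)]) (at 0)"
    by (rule has_vector_derivative_transform_within_open)
  then have pd22: "pd 2 (pd 2 ?r) p = vector [0, 0, A$1$2 * (f'' u * A$1$2) + A$2$2 * (g'' v * A$2$2)]"
    by (simp add: pd_def[of 2 "pd 2 ?r"] vector_derivative_at)
  have pd1: "pd 1 ?r p = vector [1, 0, A$1$1 * f' u + A$2$1 * g' v]"
    and pd2: "pd 2 ?r p = vector [0, 1, A$1$2 * f' u + A$2$2 * g' v]"
    using pd[OF p] by (simp_all add: u_def v_def axis_def)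
  \<comment> \<open>The first component of \<open>pd 2 ?r p\<close> is 0, so the choice operator has
    only one candidate.\<close>
  have k: "(SOME k. pd k ?r p $ 1 \<noteq> 0) = 1"
  proof (rule some_equality)
    show "pd 1 ?r p $ 1 \<noteq> 0" by (simp add: pd1)
    show "k = 1" if "pd k ?r p $ 1 \<noteq> 0" for k
      using that exhaust_2[of k] by (auto simp: pd2)
  qed
  define z where "z = A$1$2 * f' u + A$2$2 * g' v"
  have W: "surf_W ?r p = sqrt (1 + z\<^sup>2)"
    by (simp add: surf_W_def pd1 pd2 z_def add.commute)
  have "surf_L ?r p 1 2 2 = (A$1$2 * (f'' u * A$1$2) + A$2$2 * (g'' v * A$2$2)) / sqrt (1 + z\<^sup>2)"
    by (simp add: surf_L_def pd1 pd2 pd22 drop_x_def surf_N_def W inner_vector_3)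
  then show ?thesis
    unfolding z_def[symmetric] by (simp add: mean_curvature_def Let_def k pd1 pd2 W power2_eq_square power3_eq_cube mult_ac)
qed

section \<open>Cylinders over domains cut out by two strips\<close>

lemma strip_intersection:
  fixes \<alpha> \<beta> \<gamma> \<delta> :: real
  assumes "open_interval U" "open_interval V"
  defines "D \<equiv> {(t, s). \<alpha> * t + \<beta> * s \<in> U \<and> \<gamma> * t + \<delta> * s \<in> V}"
  shows "open D" and "connected D"
proof -
  have D: "D = (\<lambda>z. \<alpha> * fst z + \<beta> * snd z) -` U \<inter> (\<lambda>z. \<gamma> * fst z + \<delta> * snd z) -` V"
    by (auto simp: D_def)
  have "linear (\<lambda>z. x * fst z + y * snd z)" for x y :: real
    by (rule linearI) (auto simp: algebra_simps)
  then show "connected D"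
    using assms(1,2) unfolding D open_interval_def is_interval_convex_1
    by (intro convex_connected convex_Int convex_linear_vimage) auto
  show "open D"
    using assms(1,2) unfolding D open_interval_def
    by (intro open_Int open_vimage continuous_intros) auto
qed

text \<open>The velocity of the base curve is \<open>Q\<close> plus a multiple of \<open>E\<close>
  whose factor contains the derivative of \<open>h\<close>. Asking for independence from
  \<open>e\<close> for every factor \<open>r\<close> makes the regularity condition free of that
  derivative.\<close>

lemma cylinder_with_rulingI:
  assumes D: "open D" "connected D" and h: "smooth_on W h" and W: "\<And>t s. (t, s) \<in> D \<Longrightarrow> a * t \<in> W"
    and "e \<noteq> 0" and indep: "\<And>r. Q + r *\<^sub>R E \<notin> span {e}"
    and S: "S = (\<lambda>(t, s). P + t *\<^sub>R Q + h (a * t) *\<^sub>R E + s *\<^sub>R e) ` D"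
  shows "cylinder_with_ruling e S"
  unfolding cylinder_with_ruling_def
proof (intro conjI exI ballI)
  show "smooth_on (fst ` D) (\<lambda>t. P + t *\<^sub>R Q + h (a * t) *\<^sub>R E)"
    using W D by (intro smooth_on_affine_comp[OF h] open_image_fst) auto
  fix t assume "t \<in> fst ` D"
  then have "a * t \<in> W" using W by auto
  obtain h' where "(h has_real_derivative h') (at (a * t))"
    using smooth_onD[OF h \<open>a * t \<in> W\<close>, of 0] by auto
  then have "((\<lambda>t. h (a * t)) has_real_derivative h' * a) (at t)"
    by (rule DERIV_chain2) (auto intro!: derivative_eq_intros)
  then have "((\<lambda>t. P + t *\<^sub>R Q + h (a * t) *\<^sub>R E) has_vector_derivative
      0 + 1 *\<^sub>R Q + (h' * a) *\<^sub>R E) (at t)"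
    by (intro has_vector_derivative_add has_vector_derivative_scaleR_const has_vector_derivative_const)
      (auto intro!: derivative_eq_intros)
  then show "vector_derivative (\<lambda>t. P + t *\<^sub>R Q + h (a * t) *\<^sub>R E) (at t) \<notin> span {e}"
    using indep by (simp add: vector_derivative_at)
qed (use assms in auto)

text \<open>For fixed x the height is affine in y with a slope \<open>M\<close> that does not depend
  on x, so all these lines have the direction \<open>(0, 1, M)\<close>. The profile
  \<open>f0\<close> absorbs the part that depends on x alone, such as a function of
  \<open>A$1$1 * p$1\<close> when \<open>A$1$2 = 0\<close>.\<close>

lemma isotropic_cylinder:
  assumes U: "open_interval U" and V: "open_interval V" and f0: "smooth_on U0 f0"
    and a0: "\<And>p. p \<in> translation_domain A U V \<Longrightarrow> a0 * p$1 \<in> U0"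
    and eq: "\<And>p. p \<in> translation_domain A U V \<Longrightarrow>
      f (A$1$1 * p$1 + A$1$2 * p$2) + g (A$2$1 * p$1 + A$2$2 * p$2) = f0 (a0 * p$1) + (L * p$1 + M * p$2 + N)"
  shows "\<exists>e. cylinder_with_ruling e (translation_map A f g ` translation_domain A U V) \<and> isotropic_vector e"
proof (intro exI conjI)
  let ?D = "{(t, s). A$1$1 * t + A$1$2 * s \<in> U \<and> A$2$1 * t + A$2$2 * s \<in> V}"
  let ?e = "vector [0, 1, M] :: real^3"
  have dom: "?D = (\<lambda>p. (p$1, p$2)) ` translation_domain A U V"
  proof -
    have "(t, s) \<in> (\<lambda>p. (p$1, p$2)) ` translation_domain A U V" if "(t, s) \<in> ?D" for t s
      using that by (intro image_eqI[of _ _ "vector [t, s]"]) (auto simp: translation_domain_def)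
    then show ?thesis by (auto simp: translation_domain_def)
  qed
  show "cylinder_with_ruling ?e (translation_map A f g ` translation_domain A U V)"
  proof (rule cylinder_with_rulingI[OF strip_intersection[OF U V] f0])
    show "a0 * t \<in> U0" if "(t, s) \<in> ?D" for t s
      using that a0 unfolding dom by auto
    show "vector [1, 0, L] + r *\<^sub>R vector [0, 0, 1] \<notin> span {?e}" for r
      by (auto simp: span_singleton vec_eq_iff forall_3)
    show "?e \<noteq> 0"
      by (auto simp: vec_eq_iff forall_3)
    show "translation_map A f g ` translation_domain A U V = (\<lambda>(t, s). vector [0, 0, N]
        + t *\<^sub>R vector [1, 0, L] + f0 (a0 * t) *\<^sub>R vector [0, 0, 1] + s *\<^sub>R ?e) ` ?D"
      unfolding dom image_image
      by (intro image_cong) (auto simp: translation_map_def eq vec_eq_iff forall_3)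
  qed
  show "isotropic_vector ?e" by (simp add: isotropic_vector_def)
qed

text \<open>In the (x, y)-plane the direction \<open>(A$2$2, - A$2$1)\<close> keeps v fixed and
  changes u at the rate \<open>det A\<close>, hence changes z at the rate \<open>c1 * det A\<close>;
  this is \<open>?e\<close>. The parameters are \<open>t = v\<close> and
  \<open>s = x / A$2$2\<close>, and the base curve \<open>s = 0\<close> lies in the plane x = 0,
  where u equals \<open>A$1$2 / A$2$2 * t\<close>.\<close>

lemma non_isotropic_cylinder:
  assumes det: "det A \<noteq> 0" and U: "open_interval U" and V: "open_interval V"
    and g: "smooth_on V g" and d: "A$2$2 \<noteq> 0" and f: "\<And>t. t \<in> U \<Longrightarrow> f t = c1 * t + k0"
  shows "\<exists>e. cylinder_with_ruling e (translation_map A f g ` translation_domain A U V) \<and> \<not> isotropic_vector e"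
proof (intro exI conjI)
  let ?D = "{(t, s). (A$1$2 / A$2$2) * t + det A * s \<in> U \<and> 1 * t + 0 * s \<in> V}"
  let ?e = "vector [A$2$2, - A$2$1, c1 * det A] :: real^3"
  have dom: "?D = (\<lambda>p. (A$2$1 * p$1 + A$2$2 * p$2, p$1 / A$2$2)) ` translation_domain A U V"
  proof -
    have "(t, s) \<in> (\<lambda>p. (A$2$1 * p$1 + A$2$2 * p$2, p$1 / A$2$2)) ` translation_domain A U V"
      if "(t, s) \<in> ?D" for t s
      using that d
      by (intro image_eqI[of _ _ "vector [A$2$2 * s, t / A$2$2 - A$2$1 * s]"])
        (auto simp: translation_domain_def det_2 algebra_simps)
    moreover have "(A$2$1 * p$1 + A$2$2 * p$2, p$1 / A$2$2) \<in> ?D" if "p \<in> translation_domain A U V" for p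
    proof -
      have "(A$1$2 / A$2$2) * (A$2$1 * p$1 + A$2$2 * p$2) + det A * (p$1 / A$2$2)
          = A$1$1 * p$1 + A$1$2 * p$2"
        using d by (simp add: det_2 field_simps)
      with that show ?thesis by (auto simp: translation_domain_def)
    qed
    ultimately show ?thesis by auto
  qed
  show "cylinder_with_ruling ?e (translation_map A f g ` translation_domain A U V)"
  proof (rule cylinder_with_rulingI[OF strip_intersection[OF U V] g])
    show "1 * t \<in> V" if "(t, s) \<in> ?D" for t s
      using that by auto
    show "vector [0, 1 / A$2$2, c1 * A$1$2 / A$2$2] + r *\<^sub>R vector [0, 0, 1] \<notin> span {?e}" for r
      using d by (auto simp: span_singleton vec_eq_iff forall_3)
    show "?e \<noteq> 0"
      using d by (auto simp: vec_eq_iff forall_3)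
    show "translation_map A f g ` translation_domain A U V = (\<lambda>(t, s). vector [0, 0, k0]
        + t *\<^sub>R vector [0, 1 / A$2$2, c1 * A$1$2 / A$2$2] + g (1 * t) *\<^sub>R vector [0, 0, 1] + s *\<^sub>R ?e) ` ?D"
      unfolding dom image_image
    proof (intro image_cong refl)
      fix p assume "p \<in> translation_domain A U V"
      then have "f (A$1$1 * p$1 + A$1$2 * p$2) = c1 * (A$1$1 * p$1 + A$1$2 * p$2) + k0"
        by (simp add: translation_domain_def f)
      then show "translation_map A f g p = (case (A$2$1 * p$1 + A$2$2 * p$2, p$1 / A$2$2) of (t, s) \<Rightarrow>
          vector [0, 0, k0] + t *\<^sub>R vector [0, 1 / A$2$2, c1 * A$1$2 / A$2$2]
          + g (1 * t) *\<^sub>R vector [0, 0, 1] + s *\<^sub>R ?e)"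
        using d by (simp add: translation_map_def vec_eq_iff forall_3 det_2) (simp add: field_simps)
    qed
  qed
  show "\<not> isotropic_vector ?e" using d by (simp add: isotropic_vector_def)
qed

section \<open>The hyperbolic paraboloid\<close>

lemma open_interval_fst_image:
  fixes D :: "(real \<times> real) set"
  assumes "open D" "connected D" "D \<noteq> {}"
  shows "open_interval (fst ` D)"
  using assms open_image_fst connected_continuous_image[OF continuous_on_fst[OF continuous_on_id]]
  by (auto simp: open_interval_def is_interval_connected_1)

lemma translation_domain_nonempty:
  assumes "det A \<noteq> 0" "U \<noteq> {}" "V \<noteq> {}"
  shows "translation_domain A U V \<noteq> {}"
proof -
  from assms obtain s t where "s \<in> U" "t \<in> V" by auto
  then show ?thesis
    using ex_coordinates[OF assms(1), of s t] by (auto simp: translation_domain_def)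
qed

text \<open>The shear \<open>v = y - k x\<close> makes the \<open>x\<^sup>2\<close>-coefficient of the quadric equal to 1, so that the base
  curve is a parabolic circle even when the quadric has no \<open>x\<^sup>2\<close>-term.\<close>

lemma type_C_quadric:
  assumes det: "det A \<noteq> 0" and U: "open_interval U" and V: "open_interval V" and n: "n \<noteq> 0"
    and eq: "\<And>p. p \<in> translation_domain A U V \<Longrightarrow>
      f (A$1$1 * p$1 + A$1$2 * p$2) + g (A$2$1 * p$1 + A$2$2 * p$2)
        = m * (p$1)\<^sup>2 + n * p$1 * p$2 + (L * p$1 + M * p$2 + N)"
  shows "type_C_over_parabolic_circle (translation_map A f g ` translation_domain A U V)"
proof -
  define k where "k = (1 - m) / n"
  let ?S = "translation_map A f g ` translation_domain A U V"
  let ?D = "{(t, s). (A$1$1 + A$1$2 * k) * t + A$1$2 * s \<in> U \<and> (A$2$1 + A$2$2 * k) * t + A$2$2 * s \<in> V}"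
  \<comment> \<open>Rotation by a right angle sends (y, z) to (z, -y). The remaining terms subtract
    \<open>N\<close> and \<open>(L + M * k) * x\<close> from the new second coordinate and turn the
    third one into \<open>- v\<close>. With \<open>m + n * k = 1\<close> the second coordinate
    becomes \<open>x\<^sup>2 + v * (M + n * x)\<close>.\<close>
  let ?\<phi> = "\<lambda>q::real^3. vector [0 + q$1, - N + (- (L + M * k)) * q$1 + cos (pi/2) * q$2 + sin (pi/2) * q$3,
      0 + k * q$1 - sin (pi/2) * q$2 + cos (pi/2) * q$3] :: real^3"
  have k: "m + n * k = 1" using n by (simp add: k_def)
  have dom: "?D = (\<lambda>p. (p$1, p$2 - k * p$1)) ` translation_domain A U V"
  proof -
    have "(t, s) \<in> (\<lambda>p. (p$1, p$2 - k * p$1)) ` translation_domain A U V" if "(t, s) \<in> ?D" for t s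
      using that by (intro image_eqI[of _ _ "vector [t, s + k * t]"])
        (auto simp: translation_domain_def algebra_simps)
    then show ?thesis by (auto simp: translation_domain_def algebra_simps)
  qed
  note D = strip_intersection[OF U V]
  have "?\<phi> ` ?S = (\<lambda>(u, v). vector [u, poly [:0, 0, 1:] u + v * poly [:M, n:] u, v * poly [:-1:] u]) ` ?D"
    unfolding dom image_image
  proof (intro image_cong refl)
    fix p assume p: "p \<in> translation_domain A U V"
    have "m * (p$1)\<^sup>2 = (p$1)\<^sup>2 - n * k * (p$1)\<^sup>2"
      using k by (metis add_diff_cancel_right' left_diff_distrib mult_1)
    then show "?\<phi> (translation_map A f g p) = (case (p$1, p$2 - k * p$1) of (u, v) \<Rightarrow>
        vector [u, poly [:0, 0, 1:] u + v * poly [:M, n:] u, v * poly [:-1:] u])"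
      by (simp add: translation_map_def eq[OF p] vec_eq_iff forall_3)
        (simp add: power2_eq_square algebra_simps)
  qed
  then have "type_C_parametrization (poly [:0, 0, 1:]) (poly [:M, n:]) (poly [:-1:]) ?D (?\<phi> ` ?S)"
    unfolding type_C_parametrization_def using D by (auto simp: smooth_on_poly)
  moreover have "galilean_motion ?\<phi>"
    unfolding galilean_motion_def by blast
  moreover have "parabolic_circle ((\<lambda>u. vector [u, poly [:0, 0, 1:] u, 0]) ` fst ` ?D)"
  proof -
    have "galilean_motion (\<lambda>q. q)"
      unfolding galilean_motion_def
      by (intro exI[of _ 0]) (auto simp: fun_eq_iff vec_eq_iff forall_3)
    moreover have "?D \<noteq> {}"
      using translation_domain_nonempty[OF det] U V unfolding dom open_interval_def by blast
    then have "open_interval (fst ` ?D)"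
      by (intro open_interval_fst_image D)
    ultimately show ?thesis
      unfolding parabolic_circle_def
      by (intro exI[of _ "\<lambda>q. q"] exI[of _ 1] exI[of _ "fst ` ?D"]) (auto simp: power2_eq_square)
  qed
  ultimately show ?thesis
    unfolding type_C_over_parabolic_circle_def by blast
qed

text \<open>Each point would lie on a segment of the surface in the fixed direction
  \<open>e\<close>, which gives the tangency relation \<open>tangent\<close> on the whole open
  domain. Its left side must not vary: moving in y gives \<open>n * e$1 = 0\<close>, then moving in
  x gives \<open>n * e$2 = 0\<close>, and finally \<open>e$3 = 0\<close>.\<close>

lemma not_cylinder_quadric:
  assumes det: "det A \<noteq> 0" and U: "open_interval U" and V: "open_interval V" and n: "n \<noteq> 0"
    and eq: "\<And>p. p \<in> translation_domain A U V \<Longrightarrow>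
      f (A$1$1 * p$1 + A$1$2 * p$2) + g (A$2$1 * p$1 + A$2$2 * p$2)
        = m * (p$1)\<^sup>2 + n * p$1 * p$2 + (L * p$1 + M * p$2 + N)"
  shows "\<not> generalized_cylinder (translation_map A f g ` translation_domain A U V)"
proof
  let ?W = "translation_domain A U V"
  let ?h = "\<lambda>x y. m * x\<^sup>2 + n * x * y + (L * x + M * y + N)"
  assume "generalized_cylinder (translation_map A f g ` ?W)"
  then obtain e \<gamma> and D :: "(real \<times> real) set" where e: "e \<noteq> 0" and D: "open D"
    and S: "translation_map A f g ` ?W = (\<lambda>(t, s). \<gamma> t + s *\<^sub>R e) ` D"
    unfolding generalized_cylinder_def cylinder_with_ruling_def by blast
  have graph: "q$3 = ?h (q$1) (q$2)" if "q \<in> translation_map A f g ` ?W" for q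
    using that eq by (auto simp: translation_map_def)
  have tangent: "(2 * m * p$1 + n * p$2 + L) * e$1 + (n * p$1 + M) * e$2 = e$3" if p: "p \<in> ?W" for p
  proof -
    define q where "q = translation_map A f g p"
    have "q \<in> (\<lambda>(t, s). \<gamma> t + s *\<^sub>R e) ` D"
      unfolding S[symmetric] q_def using p by blast
    then obtain t s where ts: "(t, s) \<in> D" "q = \<gamma> t + s *\<^sub>R e" by auto
    define T where "T = (\<lambda>x. (t, s + x)) -` D"
    have T: "open T" "0 \<in> T"
      unfolding T_def using D ts by (auto intro!: open_vimage continuous_intros)
    then obtain \<epsilon> where \<epsilon>: "\<epsilon> > 0" "\<And>x. \<bar>x\<bar> < \<epsilon> \<Longrightarrow> x \<in> T"
      unfolding open_dist by (auto simp: dist_real_def)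
    have line: "q$3 + x * e$3 = ?h (q$1 + x * e$1) (q$2 + x * e$2)" if "x \<in> T" for x
    proof -
      have "q + x *\<^sub>R e \<in> (\<lambda>(t, s). \<gamma> t + s *\<^sub>R e) ` D"
        using that by (intro image_eqI[of _ _ "(t, s + x)"]) (auto simp: ts T_def scaleR_left_distrib)
      from graph[OF this[folded S]] show ?thesis by simp
    qed
    \<comment> \<open>First and second order coefficients of the quadric minus the height, along the
      line through \<open>q\<close>. Vanishing of \<open>x * (l + c * x)\<close> at two distinct
      nonzero parameters inside \<open>T\<close> forces \<open>l = 0\<close>, which is
      tangency.\<close>
    define l where "l = (2 * m * q$1 + n * q$2 + L) * e$1 + (n * q$1 + M) * e$2 - e$3"
    define c where "c = m * (e$1)\<^sup>2 + n * e$1 * e$2"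
    have quad: "x * (l + c * x) = 0" if "x \<in> T" for x
      using line[OF that] line[OF T(2)] by (simp add: l_def c_def power2_eq_square algebra_simps)
    have "l + c * (\<epsilon>/2) = 0" "l + c * (\<epsilon>/3) = 0"
      using quad[of "\<epsilon>/2"] quad[of "\<epsilon>/3"] \<epsilon> by auto
    then have "l = 0" by (simp add: field_simps)
    then show ?thesis
      by (simp add: l_def q_def translation_map_def)
  qed
  have "?W \<noteq> {}" "open ?W"
    using det U V translation_domain_nonempty open_translation_domain by (auto simp: open_interval_def)
  then obtain p \<epsilon> where p: "p \<in> ?W" and \<epsilon>: "\<epsilon> > 0" "\<And>q. dist q p < \<epsilon> \<Longrightarrow> q \<in> ?W"
    unfolding open_dist by blast
  have near: "p + (\<epsilon>/2) *\<^sub>R axis i 1 \<in> ?W" for i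
    using \<epsilon>(1) by (intro \<epsilon>(2)) (simp add: dist_norm norm_axis_1)
  have "(\<epsilon>/2) * n * e$1 = ((2 * m * p$1 + n * (p$2 + \<epsilon>/2) + L) * e$1 + (n * p$1 + M) * e$2)
      - ((2 * m * p$1 + n * p$2 + L) * e$1 + (n * p$1 + M) * e$2)"
    by (simp add: algebra_simps)
  also have "\<dots> = 0"
    using tangent[OF near[of 2]] tangent[OF p] by (simp add: axis_def)
  finally have "(\<epsilon>/2) * n * e$1 = 0" .
  then have e1: "e$1 = 0"
    using \<epsilon>(1) n by simp
  have "(\<epsilon>/2) * n * e$2 = (n * (p$1 + \<epsilon>/2) + M) * e$2 - (n * p$1 + M) * e$2"
    by (simp add: algebra_simps)
  also have "\<dots> = 0"
    using tangent[OF near[of 1]] tangent[OF p] by (simp add: axis_def e1)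
  finally have "e$2 = 0"
    using \<epsilon>(1) n by simp
  with e1 show False
    using tangent[OF p] e by (simp add: vec_eq_iff forall_3)
qed

section \<open>Vanishing mean curvature\<close>

lemma equal_derivatives_const:
  fixes f g :: "real \<Rightarrow> real"
  assumes U: "open_interval U" and f: "\<And>t. t \<in> U \<Longrightarrow> (f has_real_derivative f' t) (at t)"
    and g: "\<And>t. t \<in> U \<Longrightarrow> (g has_real_derivative f' t) (at t)"
  shows "\<exists>c. \<forall>t\<in>U. f t = g t + c"
proof -
  have "((\<lambda>t. f t - g t) has_real_derivative 0) (at t within U)" if "t \<in> U" for t
    using DERIV_diff[OF f[OF that] g[OF that]] by (simp add: has_field_derivative_at_within)
  moreover have "convex U"
    using U by (simp add: open_interval_def is_interval_convex_1)
  ultimately obtain c where "\<And>t. t \<in> U \<Longrightarrow> f t - g t = c"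
    using has_field_derivative_zero_constant[of U "\<lambda>t. f t - g t"] by blast
  then have "\<forall>t\<in>U. f t = g t + c" by (simp add: algebra_simps)
  then show ?thesis ..
qed

lemma second_derivative_const:
  fixes f :: "real \<Rightarrow> real"
  assumes U: "open_interval U" and f: "\<And>t. t \<in> U \<Longrightarrow> (f has_real_derivative f' t) (at t)"
    and f': "\<And>t. t \<in> U \<Longrightarrow> (f' has_real_derivative f'' t) (at t)"
    and k: "\<And>t. t \<in> U \<Longrightarrow> f'' t = 2 * k"
  shows "\<exists>\<alpha> \<beta>. \<forall>t\<in>U. f t = k * t\<^sup>2 + \<alpha> * t + \<beta>"
proof -
  obtain \<alpha> where "\<And>t. t \<in> U \<Longrightarrow> f' t = 2 * k * t + \<alpha>"
    using equal_derivatives_const[OF U f', of "\<lambda>t. 2 * k * t"]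
    by (auto intro!: derivative_eq_intros simp: k)
  then have "\<exists>\<beta>. \<forall>t\<in>U. f t = k * t\<^sup>2 + \<alpha> * t + \<beta>"
    by (intro equal_derivatives_const[OF U f]) (auto intro!: derivative_eq_intros)
  then show ?thesis ..
qed

lemma minimal_translation_surface:
  fixes A :: "real^2^2"
  assumes det: "det A \<noteq> 0" and U: "open_interval U" and V: "open_interval V"
    and f: "smooth_on U f" "\<And>t. t \<in> U \<Longrightarrow> (f has_real_derivative f' t) (at t)"
      "\<And>t. t \<in> U \<Longrightarrow> (f' has_real_derivative f'' t) (at t)"
    and g: "smooth_on V g" "\<And>t. t \<in> V \<Longrightarrow> (g has_real_derivative g' t) (at t)"
      "\<And>t. t \<in> V \<Longrightarrow> (g' has_real_derivative g'' t) (at t)"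
    and H: "\<And>s t. s \<in> U \<Longrightarrow> t \<in> V \<Longrightarrow> (A$1$2)\<^sup>2 * f'' s + (A$2$2)\<^sup>2 * g'' t = 0"
  defines "S \<equiv> translation_map A f g ` translation_domain A U V"
  shows "(\<exists>e. cylinder_with_ruling e S \<and> isotropic_vector e) \<or>
    (\<not> generalized_cylinder S \<and> type_C_over_parabolic_circle S)"
proof -
  obtain s0 t0 where s0: "s0 \<in> U" and t0: "t0 \<in> V"
    using U V by (auto simp: open_interval_def)
  consider "A$1$2 = 0" | "A$2$2 = 0" | "A$1$2 \<noteq> 0" "A$2$2 \<noteq> 0" by blast
  then show ?thesis
  proof cases
    case 1
    with det have d: "A$2$2 \<noteq> 0" by (auto simp: det_2)
    have "\<And>t. t \<in> V \<Longrightarrow> g'' t = 0" using H[OF s0] 1 d by simp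
    then obtain \<alpha> \<beta> where "\<forall>t\<in>V. g t = 0 * t\<^sup>2 + \<alpha> * t + \<beta>"
      using second_derivative_const[OF V g(2) g(3), of 0] by auto
    then show ?thesis
      unfolding S_def using 1
      by (intro disjI1 isotropic_cylinder[OF U V f(1), of A "A$1$1" f g "\<alpha> * A$2$1" "\<alpha> * A$2$2" \<beta>])
        (auto simp: translation_domain_def algebra_simps)
  next
    case 2
    with det have b: "A$1$2 \<noteq> 0" by (auto simp: det_2)
    have "\<And>t. t \<in> U \<Longrightarrow> f'' t = 0" using H[OF _ t0] 2 b by simp
    then obtain \<alpha> \<beta> where "\<forall>t\<in>U. f t = 0 * t\<^sup>2 + \<alpha> * t + \<beta>"
      using second_derivative_const[OF U f(2) f(3), of 0] by auto
    then show ?thesis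
      unfolding S_def using 2
      by (intro disjI1 isotropic_cylinder[OF U V g(1), of A "A$2$1" f g "\<alpha> * A$1$1" "\<alpha> * A$1$2" \<beta>])
        (auto simp: translation_domain_def algebra_simps)
  next
    case 3
    \<comment> \<open>Half the separation constant: \<open>(A$1$2)\<^sup>2 * f''\<close> is equal to
      \<open>2 * k\<close> on \<open>U\<close> and \<open>(A$2$2)\<^sup>2 * g''\<close> to
      \<open>- 2 * k\<close> on \<open>V\<close>.\<close>
    define k where "k = (A$1$2)\<^sup>2 * f'' s0 / 2"
    have "f'' s = 2 * (k / (A$1$2)\<^sup>2)" if "s \<in> U" for s
    proof -
      have "(A$1$2)\<^sup>2 * f'' s = (A$1$2)\<^sup>2 * f'' s0"
        using H[OF s0 t0] H[OF that t0] by linarith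
      with 3 show ?thesis by (simp add: k_def)
    qed
    then obtain \<alpha> \<beta> where fq: "\<forall>t\<in>U. f t = k / (A$1$2)\<^sup>2 * t\<^sup>2 + \<alpha> * t + \<beta>"
      using second_derivative_const[OF U f(2) f(3)] by blast
    have "g'' t = 2 * (- k / (A$2$2)\<^sup>2)" if "t \<in> V" for t
      using H[OF s0 that] 3 by (simp add: k_def field_simps)
    then obtain \<alpha>' \<beta>' where gq: "\<forall>t\<in>V. g t = - k / (A$2$2)\<^sup>2 * t\<^sup>2 + \<alpha>' * t + \<beta>'"
      using second_derivative_const[OF V g(2) g(3)] by blast
    \<comment> \<open>Expansion of \<open>k\<close> times the difference of the squares of
      \<open>A$1$1 / A$1$2 * x + y\<close> and \<open>A$2$1 / A$2$2 * x + y\<close>; the squares of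
      y cancel. The factor \<open>det A\<close> in \<open>n\<close> makes \<open>n\<close> nonzero
      as soon as \<open>k\<close> is.\<close>
    define m n L M N where "m = k * ((A$1$1 / A$1$2)\<^sup>2 - (A$2$1 / A$2$2)\<^sup>2)"
      and "n = 2 * k * det A / (A$1$2 * A$2$2)"
      and "L = \<alpha> * A$1$1 + \<alpha>' * A$2$1" and "M = \<alpha> * A$1$2 + \<alpha>' * A$2$2" and "N = \<beta> + \<beta>'"
    note coeffs = m_def n_def L_def M_def N_def
    have eq: "f (A$1$1 * p$1 + A$1$2 * p$2) + g (A$2$1 * p$1 + A$2$2 * p$2)
        = m * (p$1)\<^sup>2 + n * p$1 * p$2 + (L * p$1 + M * p$2 + N)" if p: "p \<in> translation_domain A U V" for p
    proof -
      have "f (A$1$1 * p$1 + A$1$2 * p$2) + g (A$2$1 * p$1 + A$2$2 * p$2)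
        = k * ((A$1$1 / A$1$2 * p$1 + p$2)\<^sup>2 - (A$2$1 / A$2$2 * p$1 + p$2)\<^sup>2) + (L * p$1 + M * p$2 + N)"
      proof -
        have square: "k / (A$i$2)\<^sup>2 * (A$i$1 * p$1 + A$i$2 * p$2)\<^sup>2 = k * (A$i$1 / A$i$2 * p$1 + p$2)\<^sup>2"
          if "A$i$2 \<noteq> 0" for i
          using that by (simp add: field_simps power2_eq_square)
        have "f (A$1$1 * p$1 + A$1$2 * p$2)
            = k * (A$1$1 / A$1$2 * p$1 + p$2)\<^sup>2 + \<alpha> * (A$1$1 * p$1 + A$1$2 * p$2) + \<beta>"
          using p fq square[OF 3(1)] by (simp add: translation_domain_def)
        moreover have "g (A$2$1 * p$1 + A$2$2 * p$2)
            = - (k * (A$2$1 / A$2$2 * p$1 + p$2)\<^sup>2) + \<alpha>' * (A$2$1 * p$1 + A$2$2 * p$2) + \<beta>'"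
          using p gq square[OF 3(2)] by (simp add: translation_domain_def)
        ultimately show ?thesis
          unfolding coeffs by (simp only: algebra_simps)
      qed
      also have "k * ((A$1$1 / A$1$2 * p$1 + p$2)\<^sup>2 - (A$2$1 / A$2$2 * p$1 + p$2)\<^sup>2)
          = m * (p$1)\<^sup>2 + n * p$1 * p$2"
      proof -
        have n: "n = 2 * k * (A$1$1 / A$1$2 - A$2$1 / A$2$2)"
          using 3 by (simp add: n_def det_2 field_simps)
        show ?thesis unfolding n m_def by (simp add: power2_eq_square algebra_simps)
      qed
      finally show ?thesis .
    qed
    show ?thesis
    proof (cases "k = 0")
      case True
      then have "m = 0" "n = 0" by (simp_all add: coeffs)
      \<comment> \<open>Both functions are affine here, so the surface is a piece of a plane; it is
        a cylinder whose profile is the zero polynomial.\<close>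
      then have "\<exists>e. cylinder_with_ruling e S \<and> isotropic_vector e"
        unfolding S_def
        by (intro isotropic_cylinder[OF U V smooth_on_poly[of UNIV 0], of A 0 f g L M N]) (auto simp: eq)
      then show ?thesis ..
    next
      case False
      then have "n \<noteq> 0" using det 3 by (simp add: n_def)
      from not_cylinder_quadric[OF det U V this eq] type_C_quadric[OF det U V this eq] show ?thesis
        unfolding S_def by (intro disjI2 conjI)
    qed
  qed
qed

section \<open>Nonzero constant mean curvature\<close>

text \<open>The shift \<open>c\<close> stands for a frozen value of \<open>G\<close>, so that the
  chain rule can take \<open>F\<close> as the inner function.\<close>

lemma has_real_derivative_sqrt_cube:
  "((\<lambda>s. sqrt (1 + (s + c)\<^sup>2) ^ 3) has_real_derivative 3 * (s + c) * sqrt (1 + (s + c)\<^sup>2)) (at s)"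
proof -
  have "1 + (s + c)\<^sup>2 > 0" by (simp add: add_pos_nonneg)
  then have root: "((\<lambda>s. sqrt (1 + (s + c)\<^sup>2)) has_real_derivative (s + c) / sqrt (1 + (s + c)\<^sup>2)) (at s)"
    by (auto intro!: derivative_eq_intros simp: field_simps)
  have "of_nat 3 * (y / R * R ^ (3 - Suc 0)) = 3 * y * R" if "R > 0" for y R :: real
    using that by (simp add: power2_eq_square)
  from this[of "sqrt (1 + (s + c)\<^sup>2)" "s + c"] show ?thesis
    using \<open>1 + (s + c)\<^sup>2 > 0\<close> by (intro DERIV_cong[OF DERIV_power[OF root]]) (simp only: real_sqrt_gt_0_iff)
qed

text \<open>Squaring and factoring leave \<open>s\<^sup>2 = r\<^sup>2\<close>, since the cofactor is
  positive. The two roots are then the same positive number and cancel, which also settles the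
  sign.\<close>

lemma mult_sqrt_inject:
  fixes s r :: real
  assumes "s * sqrt (1 + s\<^sup>2) = r * sqrt (1 + r\<^sup>2)"
  shows "s = r"
proof -
  have "(s * sqrt (1 + s\<^sup>2))\<^sup>2 = (r * sqrt (1 + r\<^sup>2))\<^sup>2" using assms by simp
  then have "s\<^sup>2 * (1 + s\<^sup>2) = r\<^sup>2 * (1 + r\<^sup>2)" by (simp add: power_mult_distrib)
  then have "(s\<^sup>2 - r\<^sup>2) * (1 + s\<^sup>2 + r\<^sup>2) = 0" by (simp add: algebra_simps)
  moreover have "1 + s\<^sup>2 + r\<^sup>2 > 0" by (simp add: add_pos_nonneg)
  ultimately have eq: "s\<^sup>2 = r\<^sup>2" by simp
  have "sqrt (1 + r\<^sup>2) > 0" by (simp add: add_pos_nonneg)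
  with assms show ?thesis unfolding eq by simp
qed

text \<open>Subtracting the equation at two points of \<open>V\<close> and differentiating in \<open>U\<close> gives
  \<open>(\<Phi>' (F s + G t\<^sub>1) - \<Phi>' (F s + G t\<^sub>2)) * F' s = 0\<close>, where \<open>\<Phi>' y = 3 * y * sqrt (1 + y\<^sup>2)\<close> is injective.\<close>

lemma separated_equation:
  fixes F G :: "real \<Rightarrow> real"
  assumes U: "open U" and H: "H \<noteq> 0" and F: "\<And>s. s \<in> U \<Longrightarrow> (F has_real_derivative F' s) (at s)"
    and eq: "\<And>s t. s \<in> U \<Longrightarrow> t \<in> V \<Longrightarrow> P s + Q t = H * sqrt (1 + (F s + G t)\<^sup>2) ^ 3"
  shows "(\<forall>s\<in>U. F' s = 0) \<or> (\<exists>\<kappa>. \<forall>t\<in>V. G t = \<kappa>)"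
proof -
  have "G t1 = G t2" if s: "s \<in> U" "F' s \<noteq> 0" and t: "t1 \<in> V" "t2 \<in> V" for s t1 t2
  proof -
    define \<Delta> where "\<Delta> = (\<lambda>s. sqrt (1 + (F s + G t1)\<^sup>2) ^ 3 - sqrt (1 + (F s + G t2)\<^sup>2) ^ 3)"
    have "(\<Delta> has_real_derivative (3 * (F s + G t1) * sqrt (1 + (F s + G t1)\<^sup>2)) * F' s
        - (3 * (F s + G t2) * sqrt (1 + (F s + G t2)\<^sup>2)) * F' s) (at s)"
      unfolding \<Delta>_def by (intro DERIV_diff DERIV_chain2[OF has_real_derivative_sqrt_cube] F s)
    moreover have "(Q t1 - Q t2) / H = \<Delta> r" if "r \<in> U" for r
    proof -
      have "H * \<Delta> r = Q t1 - Q t2"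
        using eq[OF that t(1)] eq[OF that t(2)] by (simp add: \<Delta>_def right_diff_distrib)
      with H show ?thesis by (simp add: field_simps)
    qed
    then have "(\<Delta> has_real_derivative 0) (at s)"
      by (rule has_field_derivative_transform_within_open[OF DERIV_const U s(1)])
    ultimately have "(3 * (F s + G t1) * sqrt (1 + (F s + G t1)\<^sup>2)) * F' s
        - (3 * (F s + G t2) * sqrt (1 + (F s + G t2)\<^sup>2)) * F' s = 0"
      by (rule DERIV_unique)
    then have "3 * F' s * ((F s + G t1) * sqrt (1 + (F s + G t1)\<^sup>2) - (F s + G t2) * sqrt (1 + (F s + G t2)\<^sup>2)) = 0"
      by algebra
    then have "(F s + G t1) * sqrt (1 + (F s + G t1)\<^sup>2) = (F s + G t2) * sqrt (1 + (F s + G t2)\<^sup>2)"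
      using s(2) by simp
    from mult_sqrt_inject[OF this] show ?thesis by simp
  qed
  \<comment> \<open>A single point of \<open>U\<close> with nonzero derivative already forces all
    values of \<open>G\<close> on \<open>V\<close> to agree.\<close>
  then show ?thesis by meson
qed

text \<open>The quantity \<open>q / sqrt (1 + q\<^sup>2)\<close> with \<open>q = \<kappa> + d * g'\<close> has constant derivative \<open>H / d\<close>.\<close>

lemma circle_equation:
  fixes g :: "real \<Rightarrow> real"
  assumes V: "open_interval V" and d: "d \<noteq> 0" and H: "H \<noteq> 0"
    and g: "\<And>t. t \<in> V \<Longrightarrow> (g has_real_derivative g' t) (at t)"
    and g': "\<And>t. t \<in> V \<Longrightarrow> (g' has_real_derivative g'' t) (at t)"
    and eq: "\<And>t. t \<in> V \<Longrightarrow> d\<^sup>2 * g'' t = H * sqrt (1 + (\<kappa> + d * g' t)\<^sup>2) ^ 3"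
  obtains v0 c0 where "\<And>t. t \<in> V \<Longrightarrow> 0 \<le> 1 - (H / d * (t + v0))\<^sup>2"
    "\<And>t. t \<in> V \<Longrightarrow> g t = - (1 / H * sqrt (1 - (H / d * (t + v0))\<^sup>2)) - \<kappa> / d * t + c0"
proof -
  define q where "q = (\<lambda>t. \<kappa> + d * g' t)"
  have pos: "1 + (q t)\<^sup>2 > 0" for t by (simp add: add_pos_nonneg)
  have "((\<lambda>t. q t / sqrt (1 + (q t)\<^sup>2)) has_real_derivative H / d) (at t)" if t: "t \<in> V" for t
  proof -
    let ?R = "sqrt (1 + (q t)\<^sup>2)"
    have R: "?R > 0" "?R\<^sup>2 = 1 + (q t)\<^sup>2" using pos[of t] by auto
    have q: "(q has_real_derivative d * g'' t) (at t)"
      unfolding q_def using g'[OF t] by (auto intro!: derivative_eq_intros)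
    then have r: "((\<lambda>t. sqrt (1 + (q t)\<^sup>2)) has_real_derivative q t * (d * g'' t) / ?R) (at t)"
      using pos[of t] by (auto intro!: derivative_eq_intros simp: field_simps)
    \<comment> \<open>By the quotient rule and \<open>?R\<^sup>2 - (q t)\<^sup>2 = 1\<close>, the
      derivative of \<open>q / ?R\<close> is \<open>d * g'' / ?R ^ 3\<close>; the cube in the
      equation is exactly what makes it constant.\<close>
    have "d * g'' t = H / d * ?R ^ 3"
      using eq[OF t] d by (simp add: q_def field_simps power2_eq_square)
    then have "(d * g'' t * ?R - q t * (q t * (d * g'' t) / ?R)) / (?R * ?R)
        = H / d * ((?R ^ 3 * ?R - (q t)\<^sup>2 * ?R ^ 3 / ?R) / ?R\<^sup>2)"
      by (simp add: power2_eq_square diff_divide_distrib algebra_simps)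
    also have "?R ^ 3 * ?R - (q t)\<^sup>2 * ?R ^ 3 / ?R = ?R\<^sup>2 * (?R\<^sup>2 - (q t)\<^sup>2)"
      using R(1) by (simp add: field_simps power2_eq_square power3_eq_cube)
    also have "\<dots> = ?R\<^sup>2" using R(2) by simp
    also have "H / d * (?R\<^sup>2 / ?R\<^sup>2) = H / d" using R(1) by simp
    finally show ?thesis
      using DERIV_divide[OF q r] R(1) by simp
  qed
  then obtain C where C: "\<And>t. t \<in> V \<Longrightarrow> q t / sqrt (1 + (q t)\<^sup>2) = H / d * t + C"
    using equal_derivatives_const[OF V, of "\<lambda>t. q t / sqrt (1 + (q t)\<^sup>2)" "\<lambda>_. H / d" "\<lambda>t. H / d * t"]
      DERIV_cmult_Id by blast
  define v0 where "v0 = C * d / H"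
  define \<sigma> where "\<sigma> = (\<lambda>t. H / d * (t + v0))"
  have \<sigma>: "\<sigma> t = q t / sqrt (1 + (q t)\<^sup>2)" if "t \<in> V" for t
  proof -
    have "H / d * v0 = C" using d H by (simp add: v0_def)
    with C[OF that] show ?thesis by (simp add: \<sigma>_def distrib_left)
  qed
  \<comment> \<open>This keeps the radicand positive, and it inverts the substitution:
    \<open>q\<close> is recovered as \<open>\<sigma> / sqrt (1 - \<sigma>\<^sup>2)\<close>.\<close>
  have \<sigma>2: "1 - (\<sigma> t)\<^sup>2 = 1 / (1 + (q t)\<^sup>2)" if "t \<in> V" for t
  proof -
    have "(\<sigma> t)\<^sup>2 = (q t)\<^sup>2 / (1 + (q t)\<^sup>2)"
      using \<sigma>[OF that] pos[of t] by (simp add: power_divide)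
    with pos[of t] show ?thesis by (simp add: field_simps)
  qed
  \<comment> \<open>The linear term comes from \<open>g' = (q - \<kappa>) / d\<close>.\<close>
  have "((\<lambda>t. - (1 / H * sqrt (1 - (\<sigma> t)\<^sup>2)) - \<kappa> / d * t) has_real_derivative g' t) (at t)" if t: "t \<in> V" for t
  proof -
    have "1 - (\<sigma> t)\<^sup>2 > 0" using \<sigma>2[OF t] pos by simp
    moreover have "(\<sigma> has_real_derivative H / d) (at t)"
      unfolding \<sigma>_def using d by (auto intro!: derivative_eq_intros)
    ultimately have "((\<lambda>t. sqrt (1 - (\<sigma> t)\<^sup>2)) has_real_derivative - (\<sigma> t * (H / d)) / sqrt (1 - (\<sigma> t)\<^sup>2)) (at t)"
      by (auto intro!: derivative_eq_intros simp: field_simps)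
    then have "((\<lambda>t. - (1 / H * sqrt (1 - (\<sigma> t)\<^sup>2)) - \<kappa> / d * t) has_real_derivative
        - (1 / H * (- (\<sigma> t * (H / d)) / sqrt (1 - (\<sigma> t)\<^sup>2))) - \<kappa> / d) (at t)"
      by (intro DERIV_diff DERIV_minus DERIV_cmult DERIV_cmult_Id)
    moreover have "\<sigma> t / sqrt (1 - (\<sigma> t)\<^sup>2) = q t"
      unfolding \<sigma>2[OF t] unfolding \<sigma>[OF t] using pos[of t] by (simp add: real_sqrt_divide)
    then have "\<sigma> t / (d * sqrt (1 - (\<sigma> t)\<^sup>2)) = q t / d"
      by (metis divide_divide_eq_left mult.commute)
    then have "- (1 / H * (- (\<sigma> t * (H / d)) / sqrt (1 - (\<sigma> t)\<^sup>2))) - \<kappa> / d = q t / d - \<kappa> / d"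
      using H by (simp add: field_simps)
    ultimately show ?thesis using d by (simp add: q_def field_simps)
  qed
  then obtain c0 where "\<And>t. t \<in> V \<Longrightarrow> g t = - (1 / H * sqrt (1 - (\<sigma> t)\<^sup>2)) - \<kappa> / d * t + c0"
    using equal_derivatives_const[OF V g] by blast
  moreover have "0 \<le> 1 - (\<sigma> t)\<^sup>2" if "t \<in> V" for t
    using \<sigma>2[OF that] pos[of t] by simp
  ultimately show ?thesis
    using that unfolding \<sigma>_def by blast
qed

text \<open>The space is translated by \<open>\<omega>\<close> in the first two coordinates and by
  \<open>- c\<close> in the third; the region \<open>E\<close> is the shifted domain.\<close>

lemma translated_graphI:
  assumes "\<And>p. p \<in> translation_domain A U V \<Longrightarrow> p + \<omega> \<in> M"
    and "\<And>p. p \<in> translation_domain A U V \<Longrightarrow>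
      f (A$1$1 * p$1 + A$1$2 * p$2) + g (A$2$1 * p$1 + A$2$2 * p$2) = h (p + \<omega>) + c"
  shows "translated_graph h M (translation_map A f g ` translation_domain A U V)"
  unfolding translated_graph_def
proof (intro exI conjI)
  show "(\<lambda>p. p + \<omega>) ` translation_domain A U V \<subseteq> M"
    using assms(1) by auto
  show "(\<lambda>q. q + vector [\<omega>$1, \<omega>$2, - c]) ` translation_map A f g ` translation_domain A U V
      = (\<lambda>p. vector [p$1, p$2, h p]) ` (\<lambda>p. p + \<omega>) ` translation_domain A U V"
    unfolding image_image
    by (intro image_cong) (auto simp: translation_map_def assms(2) vec_eq_iff forall_3)
qed

lemma cmc_translation_surface:
  fixes A :: "real^2^2"
  assumes det: "det A \<noteq> 0" and U: "open_interval U" and V: "open_interval V" and H0: "H0 \<noteq> 0"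
    and f: "\<And>t. t \<in> U \<Longrightarrow> (f has_real_derivative f' t) (at t)"
    and const: "\<And>t. t \<in> U \<Longrightarrow> A$1$2 * f' t = \<kappa>"
    and g: "smooth_on V g" "\<And>t. t \<in> V \<Longrightarrow> (g has_real_derivative g' t) (at t)"
      "\<And>t. t \<in> V \<Longrightarrow> (g' has_real_derivative g'' t) (at t)"
    and eq: "\<And>t. t \<in> V \<Longrightarrow> (A$2$2)\<^sup>2 * g'' t = H0 * sqrt (1 + (\<kappa> + A$2$2 * g' t)\<^sup>2) ^ 3"
  defines "S \<equiv> translation_map A f g ` translation_domain A U V"
  shows "cmc_form_1 A f U H0 S \<or> cmc_form_2 A H0 S"
proof -
  obtain s0 t0 where s0: "s0 \<in> U" and t0: "t0 \<in> V"
    using U V by (auto simp: open_interval_def)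
  \<comment> \<open>With \<open>A$2$2 = 0\<close> the left side of the equation vanishes, while the
    right side is \<open>H0\<close> times a positive number.\<close>
  have d: "A$2$2 \<noteq> 0"
  proof
    assume "A$2$2 = 0"
    with eq[OF t0] H0 have "sqrt (1 + \<kappa>\<^sup>2) = 0" by simp
    then show False by (smt (verit) real_sqrt_eq_zero_cancel_iff zero_le_power2)
  qed
  obtain v0 c0 where dom: "\<And>t. t \<in> V \<Longrightarrow> 0 \<le> 1 - (H0 / A$2$2 * (t + v0))\<^sup>2"
    and geq: "\<And>t. t \<in> V \<Longrightarrow> g t = - (1 / H0 * sqrt (1 - (H0 / A$2$2 * (t + v0))\<^sup>2)) - \<kappa> / A$2$2 * t + c0"
    using circle_equation[OF V d H0 g(2,3) eq] by blast
  \<comment> \<open>A shift in y alone adds \<open>v0\<close> to v and leaves x untouched, so the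
    term \<open>f (A$1$1 * p$1)\<close> of the first form is preserved.\<close>
  define \<omega> :: "real^2" where "\<omega> = vector [0, v0 / A$2$2]"
  have shift: "A$2$1 * p$1 + A$2$2 * (p + \<omega>)$2 = A$2$1 * p$1 + A$2$2 * p$2 + v0"
    "(p + \<omega>)$1 = p$1" for p
    using d by (simp_all add: \<omega>_def algebra_simps)
  show ?thesis
  proof (cases "A$1$2 = 0")
    case True
    then have "\<kappa> = 0" using const[OF s0] by simp
    have "cmc_form_1 A f U H0 S"
      unfolding cmc_form_1_def S_def using True d
      by (intro conjI translated_graphI[where \<omega> = \<omega> and c = c0])
        (auto simp: shift translation_domain_def dom[simplified] geq \<open>\<kappa> = 0\<close> simp del: vector_add_component)
    then show ?thesis ..
  next
    case False
    have "(f has_real_derivative \<kappa> / A$1$2) (at t)" if "t \<in> U" for t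
      using f[OF that] const[OF that] False by (metis nonzero_mult_div_cancel_left)
    then obtain k0 where feq: "\<And>t. t \<in> U \<Longrightarrow> f t = \<kappa> / A$1$2 * t + k0"
      using equal_derivatives_const[OF U, of f "\<lambda>_. \<kappa> / A$1$2" "\<lambda>t. \<kappa> / A$1$2 * t"]
        DERIV_cmult_Id by blast
    \<comment> \<open>The slope of f times u and the linear term of g combine so that y drops out;
      the constant \<open>c1\<close> of the second form is this slope
      \<open>\<kappa> / A$1$2\<close>.\<close>
    have lin: "\<kappa> / A$1$2 * (A$1$1 * p$1 + A$1$2 * p$2) - \<kappa> / A$2$2 * (A$2$1 * p$1 + A$2$2 * p$2)
        = \<kappa> / A$1$2 * det A / A$2$2 * p$1" for p :: "real^2"
      using False d by (simp add: det_2 field_simps)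
    have "translated_graph (\<lambda>p. \<kappa> / A$1$2 * det A / A$2$2 * p$1
        - 1 / H0 * sqrt (1 - (H0 / A$2$2 * (A$2$1 * p$1 + A$2$2 * p$2))\<^sup>2))
       {p. 0 \<le> 1 - (H0 / A$2$2 * (A$2$1 * p$1 + A$2$2 * p$2))\<^sup>2} S"
      unfolding S_def
    proof (rule translated_graphI[where \<omega> = \<omega> and c = "k0 + c0"], goal_cases)
      case (1 p)
      then show ?case
        by (simp add: shift translation_domain_def dom[simplified] del: vector_add_component)
    next
      case (2 p)
      then have "A$1$1 * p$1 + A$1$2 * p$2 \<in> U" "A$2$1 * p$1 + A$2$2 * p$2 \<in> V"
        by (auto simp: translation_domain_def)
      then show ?case
        unfolding shift using feq geq lin[of p] by simp
    qed
    then have "cmc_form_2 A H0 S"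
      unfolding cmc_form_2_def
      using d non_isotropic_cylinder[OF det U V g(1) d feq, folded S_def] by blast
    then show ?thesis ..
  qed
qed

section \<open>From constant mean curvature to the separated equations\<close>

theorem theorem3p2:
  fixes A :: "real^2^2" and f g :: "real \<Rightarrow> real" and U V :: "real set" and H0 :: real
    and S :: "(real^3) set"
  assumes "det A \<noteq> 0"
    and "open_interval U" and "open_interval V"
    and "smooth_on U f" and "smooth_on V g"
    and "\<forall>p\<in>translation_domain A U V. mean_curvature (translation_map A f g) p = H0"
    and "S = translation_map A f g ` translation_domain A U V"
  shows "(H0 = 0 \<longrightarrow>
            (\<exists>P. isotropic_plane P \<and> openin (top_of_set P) S) \<or>
            (\<exists>e. cylinder_with_ruling e S \<and> isotropic_vector e) \<or>
            (\<not> generalized_cylinder S \<and> type_C_over_parabolic_circle S)) \<and>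
         (H0 \<noteq> 0 \<longrightarrow>
            cmc_form_1 A f U H0 S \<or> cmc_form_2 A H0 S \<or>
            cmc_form_1 (swap_rows A) g V H0 S \<or> cmc_form_2 (swap_rows A) H0 S)"
proof -
  obtain f' f'' where f: "\<And>t. t \<in> U \<Longrightarrow> (f has_real_derivative f' t) (at t)"
    "\<And>t. t \<in> U \<Longrightarrow> (f' has_real_derivative f'' t) (at t)"
    using smooth_on_real_cases[OF assms(4)] by blast
  obtain g' g'' where g: "\<And>t. t \<in> V \<Longrightarrow> (g has_real_derivative g' t) (at t)"
    "\<And>t. t \<in> V \<Longrightarrow> (g' has_real_derivative g'' t) (at t)"
    using smooth_on_real_cases[OF assms(5)] by blast
  have UV: "open U" "open V" using assms(2,3) by (auto simp: open_interval_def)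
  have H: "(A$1$2)\<^sup>2 * f'' s + (A$2$2)\<^sup>2 * g'' t = H0 * sqrt (1 + (A$1$2 * f' s + A$2$2 * g' t)\<^sup>2) ^ 3"
    if "s \<in> U" "t \<in> V" for s t
  proof -
    obtain p :: "real^2" where p: "A$1$1 * p$1 + A$1$2 * p$2 = s" "A$2$1 * p$1 + A$2$2 * p$2 = t"
      using ex_coordinates[OF assms(1)] by metis
    then have "p \<in> translation_domain A U V" using that by (simp add: translation_domain_def)
    from mean_curvature_translation_map[OF UV this f g] assms(6) this
    have "H0 = ((A$1$2)\<^sup>2 * f'' s + (A$2$2)\<^sup>2 * g'' t) / sqrt (1 + (A$1$2 * f' s + A$2$2 * g' t)\<^sup>2) ^ 3"
      unfolding p by simp
    moreover have "1 + (A$1$2 * f' s + A$2$2 * g' t)\<^sup>2 > 0" by (simp add: add_pos_nonneg)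
    ultimately show ?thesis by simp
  qed
  obtain s0 t0 where s0: "s0 \<in> U" and t0: "t0 \<in> V"
    using assms(2,3) by (auto simp: open_interval_def)
  show ?thesis
  proof (intro conjI impI)
    assume "H0 = 0"
    then have "(A$1$2)\<^sup>2 * f'' s + (A$2$2)\<^sup>2 * g'' t = 0" if "s \<in> U" "t \<in> V" for s t
      using H[OF that] by simp
    then show "(\<exists>P. isotropic_plane P \<and> openin (top_of_set P) S) \<or>
        (\<exists>e. cylinder_with_ruling e S \<and> isotropic_vector e) \<or>
        (\<not> generalized_cylinder S \<and> type_C_over_parabolic_circle S)"
      \<comment> \<open>A piece of an isotropic plane is also a cylinder with isotropic rulings, so
        it is covered by the second alternative.\<close>
      unfolding assms(7) by (intro disjI2 minimal_translation_surface[OF assms(1-4) f assms(5) g])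
  next
    assume H0: "H0 \<noteq> 0"
    have Ff: "((\<lambda>s. A$1$2 * f' s) has_real_derivative A$1$2 * f'' s) (at s)" if "s \<in> U" for s
      by (intro DERIV_cmult f that)
    have "(\<forall>s\<in>U. A$1$2 * f'' s = 0) \<or> (\<exists>\<kappa>. \<forall>t\<in>V. A$2$2 * g' t = \<kappa>)"
      by (rule separated_equation[where F = "\<lambda>s. A$1$2 * f' s" and G = "\<lambda>t. A$2$2 * g' t"
            and P = "\<lambda>s. (A$1$2)\<^sup>2 * f'' s" and Q = "\<lambda>t. (A$2$2)\<^sup>2 * g'' t", OF UV(1) H0 Ff H])
    \<comment> \<open>The alternatives have different forms: a vanishing derivative, which is
      integrated to obtain \<open>\<kappa>\<close>, and a constant function, which is differentiated
      at \<open>t0\<close>. In both cases fixing one variable then leaves an equation for the other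
      function alone; the second case is reduced to the first by interchanging the rows.\<close>
    then consider "\<forall>s\<in>U. A$1$2 * f'' s = 0" | \<kappa> where "\<forall>t\<in>V. A$2$2 * g' t = \<kappa>"
      by blast
    then show "cmc_form_1 A f U H0 S \<or> cmc_form_2 A H0 S \<or>
            cmc_form_1 (swap_rows A) g V H0 S \<or> cmc_form_2 (swap_rows A) H0 S"
    proof cases
      case 1
      have "((\<lambda>s. A$1$2 * f' s) has_real_derivative 0) (at s)" if "s \<in> U" for s
        using Ff[OF that] bspec[OF 1 that] by (simp only:)
      then have "\<exists>\<kappa>. \<forall>s\<in>U. A$1$2 * f' s = 0 + \<kappa>"
        by (rule equal_derivatives_const[OF assms(2)]) simp_all
      then obtain \<kappa> where \<kappa>: "\<And>s. s \<in> U \<Longrightarrow> A$1$2 * f' s = \<kappa>" by auto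
      have f0: "(A$1$2)\<^sup>2 * f'' s0 = 0"
        using bspec[OF 1 s0] by (simp add: power2_eq_square)
      have "(A$2$2)\<^sup>2 * g'' t = H0 * sqrt (1 + (\<kappa> + A$2$2 * g' t)\<^sup>2) ^ 3" if "t \<in> V" for t
        using H[OF s0 that] \<kappa>[OF s0] f0 by simp
      then have "cmc_form_1 A f U H0 S \<or> cmc_form_2 A H0 S"
        unfolding assms(7) using \<kappa> by (intro cmc_translation_surface[OF assms(1-3) H0 f(1) _ assms(5) g])
      then show ?thesis by blast
    next
      case 2
      let ?B = "swap_rows A"
      have B: "?B$1$2 = A$2$2" "?B$2$2 = A$1$2" by (simp_all add: swap_rows_def)
      have "A$2$2 * g'' t0 = 0"
      proof (rule DERIV_unique)
        show "((\<lambda>t. A$2$2 * g' t) has_real_derivative A$2$2 * g'' t0) (at t0)"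
          by (intro DERIV_cmult g t0)
        show "((\<lambda>t. A$2$2 * g' t) has_real_derivative 0) (at t0)"
          using 2 by (intro has_field_derivative_transform_within_open[OF DERIV_const UV(2) t0]) auto
      qed
      then have g0: "(A$2$2)\<^sup>2 * g'' t0 = 0"
        by (simp add: power2_eq_square)
      have "(A$1$2)\<^sup>2 * f'' s = H0 * sqrt (1 + (\<kappa> + A$1$2 * f' s)\<^sup>2) ^ 3" if "s \<in> U" for s
        using H[OF that t0] bspec[OF 2 t0] unfolding g0 by (simp add: add.commute)
      then have "cmc_form_1 ?B g V H0 (translation_map ?B g f ` translation_domain ?B V U) \<or>
          cmc_form_2 ?B H0 (translation_map ?B g f ` translation_domain ?B V U)"
        using 2 assms(1)
        by (intro cmc_translation_surface[OF _ assms(3,2) H0 g(1) _ assms(4) f])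
          (auto simp: B det_swap_rows)
      then show ?thesis
        unfolding translation_map_swap translation_domain_swap assms(7) by blast
    qed
  qed
qed

end
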